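(* Given an integer constant $c\ge 3$ and an input array of size $n$, the optimized Melbourne shuffle (in its recursive small-message version) executes $O(c\,n^{(c-1)/c})$ operations, each exchanging a message of size $O(n^{1/c})$, between a user with private memory of size $O(n^{1/c})$ and a server with storage of size $O(n)$. Also, the user and the server perform $O(cn)$ work.
   Context: Conventions. Divisibility and rounding are ignored. Sizes are measured in number of elements (plus constant space for a key and permutation seeds); work is measured in elementary steps, with one encryption, decryption or evaluation of a permutation on one element counted as one step. Elements are equal-size pairs $(x,v)$ with distinct keys $x\in[1,n]$; shuffling according to $\rho$ means moving the element with key $x$ to position $\rho(x)$ of the output array. Storage model. A client (user) accesses arrays on a server through operations getRange (read a contiguous range of an array), putRange (write a contiguous range), and getRangeDist, putRangeDist (read/write several ranges in one operation). Each call is one operation; its message size is the total number of elements transferred; the server's work for it is proportional to that number. All elements on the server are encrypted; each element read is decrypted and re-encrypted before being written back. Small-message optimized Melbourne shuffle. To shuffle an input $I$ according to $\pi$ into $O$, a pass is run first for a random permutation $\pi_1$ and then, on the result, for $\pi$. A pass for a permutation $\rho$ has $c-1$ recursive levels followed by a clean-up. At level $i\in\{1,\dots,c-1\}$ the current array consists of $n^{(i-1)/c}$ consecutive blocks; each block contains (together with dummies) exactly the elements whose target positions under $\rho$ lie in one interval of $n^{(c-i+1)/c}$ consecutive positions of $O$, and is stored as $n^{(c-i)/c}$ buckets of size $O(n^{1/c})$. Each block is distributed among $n^{1/c}$ output sub-blocks, each corresponding to an interval of $n^{(c-i)/c}$ consecutive target positions, by the two-phase distribution of the optimized Melbourne shuffle: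 in the first phase the sub-blocks are grouped into $n^{1/(2c)}$ chunks, and from each bucket read, one batch per chunk of the real elements targeted there, padded with dummies to a fixed size $p_1 n^{1/(2c)}$, is written; in the second phase, from each bucket of size $O(n^{1/c})$ read in a chunk, one batch per sub-block of that chunk, padded with dummies to a fixed size $p_2n^{1/(2c)}$, is written. Here $p_1,p_2>1$ are constants, dummies read are discarded, and the algorithm fails if some batch would exceed its fixed size. All batches produced from one bucket are written in one operation. After level $c-1$, each bucket of size $O(n^{1/c})$ contains exactly the $n^{1/c}$ real elements belonging to one bucket of $O$; the clean-up reads each such bucket, removes dummies, sorts by $\rho(x)$, re-encrypts and writes the $n^{1/c}$ elements to the corresponding bucket of $O$. *)

theory Defs
  imports "HOL-Probability.Probability_Mass_Function" "HOL-Combinatorics.Permutations"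
begin

text \<open>
  The shuffle is written as an imperative program acting on an explicit machine state: the arrays
  held by the server, the private memory of the user, and the cost counters.  Elements only live
  in the server arrays and in the private memory recorded in the state; what the program text
  itself carries around is a bounded number of loop indices.
\<close>

datatype 'v cell = Dummy | Real nat 'v

text \<open>
  An encryption scheme under the user's fixed key.  The first argument of \<open>enc\<close> is the index of
  the random coins that are used; every encryption uses a new index.
\<close>

record ('v, 'ct) scheme =
  enc :: "nat \<Rightarrow> 'v cell \<Rightarrow> 'ct"
  dec :: "'ct \<Rightarrow> 'v cell"

definition correct_scheme :: "('v, 'ct) scheme \<Rightarrow> bool" where
  "correct_scheme E \<longleftrightarrow> (\<forall>r x. dec E (enc E r x) = x)"

text \<open>
  \<open>Mid\<close> is the result of the first pass; \<open>Aux1\<close> and \<open>Aux2\<close> receive the batches of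
  the first and of the second distribution phase and are reused by all levels of both passes.
\<close>

datatype arr = In | Mid | Out | Aux1 | Aux2

text \<open>
  Private memory: \<open>received\<close> is a message that is being processed, \<open>batches\<close> are the
  decrypted batches under construction, \<open>sealed\<close> are the re-encrypted batches to be sent.
  \<open>messages\<close> has one entry for each operation, namely the number of elements transferred.
\<close>

record ('v, 'ct) state =
  server :: "arr \<Rightarrow> 'ct list"
  received :: "'ct list"
  batches :: "'v cell list list"
  sealed :: "'ct list list"
  coin :: nat
  failed :: bool
  messages :: "nat list"
  user_work :: nat
  server_work :: nat
  user_peak :: nat
  server_peak :: nat

definition private_size :: "('v, 'ct) state \<Rightarrow> nat" where
  "private_size s = length (received s) + sum_list (map length (batches s))
     + sum_list (map length (sealed s))"

definition storage_size :: "(arr \<Rightarrow> 'ct list) \<Rightarrow> nat" where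
  "storage_size srv = (\<Sum>a\<in>{In, Mid, Out, Aux1, Aux2}. length (srv a))"

definition num_operations :: "('v, 'ct) state \<Rightarrow> nat" where
  "num_operations s = length (messages s)"

definition update_peaks :: "('v, 'ct) state \<Rightarrow> ('v, 'ct) state" where
  "update_peaks s = s\<lparr>user_peak := max (user_peak s) (private_size s),
                      server_peak := max (server_peak s) (storage_size (server s))\<rparr>"

type_synonym ('v, 'ct) prog = "('v, 'ct) state \<Rightarrow> ('v, 'ct) state"

text \<open>A failed run stops at the point of failure and keeps the costs incurred so far.\<close>

definition seq :: "('v, 'ct) prog \<Rightarrow> ('v, 'ct) prog \<Rightarrow> ('v, 'ct) prog"  (infixr ";;" 55) where
  "(p ;; q) s = (let s' = p s in if failed s' then s' else q s')"

text \<open>\<open>user_step w f\<close>: the user changes the private memory by \<open>f\<close>, in \<open>w\<close> elementary steps.\<close>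

definition user_step :: "nat \<Rightarrow> ('v, 'ct) prog \<Rightarrow> ('v, 'ct) prog" where
  "user_step w f s = (let s' = f s in update_peaks (s'\<lparr>user_work := user_work s' + w\<rparr>))"

primrec loop :: "nat \<Rightarrow> (nat \<Rightarrow> ('v, 'ct) prog) \<Rightarrow> ('v, 'ct) prog" where
  "loop 0 body = id"
| "loop (Suc k) body = (loop k body ;; user_step 1 id ;; body k)"


subsection \<open>Operations on the server\<close>

text \<open>Every operation costs server and user one step for each element transferred.\<close>

definition exchange :: "nat \<Rightarrow> ('v, 'ct) prog \<Rightarrow> ('v, 'ct) prog" where
  "exchange len f s = (let s' = f s in update_peaks
     (s'\<lparr>messages := messages s' @ [len],
         server_work := server_work s' + len,
         user_work := user_work s' + len\<rparr>))"

text \<open>Ranges are given by their first index (counted from 0) and their length.\<close>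

definition read_range :: "'a list \<Rightarrow> nat \<times> nat \<Rightarrow> 'a list" where
  "read_range xs r = take (snd r) (drop (fst r) xs)"

definition write_range :: "nat \<times> 'a list \<Rightarrow> 'a list \<Rightarrow> 'a list" where
  "write_range w xs =
     take (fst w) xs @ take (length xs - fst w) (snd w) @ drop (fst w + length (snd w)) xs"

definition getRangeDist :: "arr \<Rightarrow> (nat \<times> nat) list \<Rightarrow> ('v, 'ct) prog" where
  "getRangeDist a rs s = (let msg = concat (map (read_range (server s a)) rs)
     in exchange (length msg) (\<lambda>s. s\<lparr>received := msg\<rparr>) s)"

definition getRange :: "arr \<Rightarrow> nat \<Rightarrow> nat \<Rightarrow> ('v, 'ct) prog" where
  "getRange a start len = getRangeDist a [(start, len)]"

definition put_ranges :: "arr \<Rightarrow> (nat \<times> 'ct list) list \<Rightarrow> ('v, 'ct) prog" where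
  "put_ranges a ws = exchange (sum_list (map (length \<circ> snd) ws))
     (\<lambda>s. s\<lparr>server := (server s)(a := fold write_range ws (server s a)), sealed := []\<rparr>)"

text \<open>
  \<open>putRangeDist\<close> sends the \<open>k\<close>-th sealed batch to position \<open>start k\<close>; \<open>putRange\<close> sends the
  concatenation of the sealed batches to one contiguous range.
\<close>

definition putRangeDist :: "arr \<Rightarrow> (nat \<Rightarrow> nat) \<Rightarrow> ('v, 'ct) prog" where
  "putRangeDist a start s =
     put_ranges a (map (\<lambda>k. (start k, sealed s ! k)) [0..<length (sealed s)]) s"

definition putRange :: "arr \<Rightarrow> nat \<Rightarrow> ('v, 'ct) prog" where
  "putRange a start s = put_ranges a [(start, concat (sealed s))] s"


subsection \<open>Local work of the user\<close>

definition open_batches :: "nat \<Rightarrow> ('v, 'ct) prog" where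
  "open_batches K = user_step K (\<lambda>s. s\<lparr>batches := replicate K [], sealed := replicate K []\<rparr>)"

text \<open>
  Takes the next received cell, decrypts it, discards it if it is a dummy, and otherwise
  evaluates the permutation \<open>\<rho>\<close> on its key and appends it to the batch selected by its target
  position; fails if this would make the batch larger than \<open>b\<close>.  The target position \<open>\<rho> x\<close>
  is in \<open>{1..n}\<close>; batches are selected by the 0-based position \<open>\<rho> x - 1\<close>.
  The steps counted are fetch, decryption and dummy test, and for a real element also
  evaluation of \<open>\<rho>\<close>, selection of the batch, size test and append.
\<close>

definition route :: "('v, 'ct) scheme \<Rightarrow> (nat \<Rightarrow> nat) \<Rightarrow> (nat \<Rightarrow> nat) \<Rightarrow> nat \<Rightarrow> ('v, 'ct) prog" where
  "route E \<rho> idx b s = (case received s of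
      [] \<Rightarrow> user_step 1 id s
    | y # ys \<Rightarrow> (case dec E y of
        Dummy \<Rightarrow> user_step 3 (\<lambda>s. s\<lparr>received := ys\<rparr>) s
      | Real x v \<Rightarrow>
          (let k = idx (\<rho> x - 1); B = batches s ! k in
           if length B < b
           then user_step 7 (\<lambda>s. s\<lparr>received := ys, batches := (batches s)[k := B @ [Real x v]]\<rparr>) s
           else user_step 6 (\<lambda>s. s\<lparr>failed := True\<rparr>) s)))"

definition pad :: "nat \<Rightarrow> nat \<Rightarrow> ('v, 'ct) prog" where
  "pad b k = user_step 2 (\<lambda>s. if length (batches s ! k) < b
     then s\<lparr>batches := (batches s)[k := batches s ! k @ [Dummy]]\<rparr> else s)"

text \<open>Moves the next cell of batch \<open>k\<close>, freshly encrypted, to the outgoing message: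
  fetch, encryption, append.\<close>

definition seal :: "('v, 'ct) scheme \<Rightarrow> nat \<Rightarrow> ('v, 'ct) prog" where
  "seal E k = user_step 3 (\<lambda>s. case batches s ! k of
      [] \<Rightarrow> s
    | y # ys \<Rightarrow> s\<lparr>batches := (batches s)[k := ys],
                  sealed := (sealed s)[k := sealed s ! k @ [enc E (coin s) y]],
                  coin := Suc (coin s)\<rparr>)"

text \<open>
  Splits a received message of \<open>L\<close> cells into \<open>K\<close> re-encrypted batches of exactly \<open>b\<close> cells.
\<close>

definition distribute ::
    "('v, 'ct) scheme \<Rightarrow> (nat \<Rightarrow> nat) \<Rightarrow> (nat \<Rightarrow> nat) \<Rightarrow> nat \<Rightarrow> nat \<Rightarrow> nat \<Rightarrow> ('v, 'ct) prog" where
  "distribute E \<rho> idx L K b =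
     open_batches K ;;
     loop L (\<lambda>_. route E \<rho> idx b) ;;
     loop K (\<lambda>k. loop b (\<lambda>_. pad b k)) ;;
     loop K (\<lambda>k. loop b (\<lambda>_. seal E k))"


subsection \<open>The shuffle\<close>

text \<open>
  Throughout, \<open>m\<close> stands for $n^{1/(2c)}$, so that \<open>n = m ^ (2 * c)\<close> and \<open>m\<^sup>2\<close> is $n^{1/c}$.
\<close>

definition batch_size :: "real \<Rightarrow> nat \<Rightarrow> nat" where
  "batch_size p m = nat \<lceil>p * real m\<rceil>"

text \<open>
  Level \<open>i\<close> of a pass.  A block has \<open>nb\<close> buckets and covers \<open>nb * m\<^sup>2\<close> target positions; each of
  its \<open>m\<close> chunks covers \<open>nb * m\<close> and each of its \<open>m\<^sup>2\<close> sub-blocks covers \<open>nb\<close> target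
  positions.  In \<open>Aux1\<close>, a chunk consists of \<open>nb\<close> batches of size \<open>b1\<close>, read back in buckets
  of \<open>m\<close> batches.  In \<open>Aux2\<close>, a sub-block consists of \<open>nb div m\<close> batches of size \<open>b2\<close>, which on
  the next level form \<open>nb div m\<^sup>2\<close> buckets of size \<open>m * b2\<close>; the sub-blocks of a block
  take the place of that block.
\<close>

definition level ::
    "('v, 'ct) scheme \<Rightarrow> real \<Rightarrow> real \<Rightarrow> nat \<Rightarrow> nat \<Rightarrow> (nat \<Rightarrow> nat) \<Rightarrow> arr \<Rightarrow> nat \<Rightarrow> ('v, 'ct) prog"
  where
  "level E p1 p2 c m \<rho> src i =
    (let b1 = batch_size p1 m;
         b2 = batch_size p2 m;
         nb = (m\<^sup>2) ^ (c - i);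
         cur = (if i = 1 then src else Aux2);
         bucket = (if i = 1 then m\<^sup>2 else m * b2)
     in loop ((m\<^sup>2) ^ (i - 1)) (\<lambda>j.
          loop nb (\<lambda>t.
            getRange cur ((j * nb + t) * bucket) bucket ;;
            distribute E \<rho> (\<lambda>pos. pos div (nb * m) mod m) bucket m b1 ;;
            putRangeDist Aux1 (\<lambda>k. ((j * m + k) * nb + t) * b1)) ;;
          loop m (\<lambda>k. loop (nb div m) (\<lambda>q.
            getRange Aux1 (((j * m + k) * nb + q * m) * b1) (m * b1) ;;
            distribute E \<rho> (\<lambda>pos. pos div nb mod m) (m * b1) m b2 ;;
            putRangeDist Aux2 (\<lambda>l. ((j * m\<^sup>2 + k * m + l) * (nb div m) + q) * b2)))))"

text \<open>
  The real elements of the \<open>j\<close>-th bucket are those with the \<open>m\<^sup>2\<close> consecutive target positions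
  starting at \<open>j * m\<^sup>2\<close>.  They are sorted in linear time by bucket sort, that is, by distribution
  into \<open>m\<^sup>2\<close> batches of size 1 according to the target position.
\<close>

definition clean_up ::
    "('v, 'ct) scheme \<Rightarrow> real \<Rightarrow> nat \<Rightarrow> nat \<Rightarrow> (nat \<Rightarrow> nat) \<Rightarrow> arr \<Rightarrow> ('v, 'ct) prog" where
  "clean_up E p2 c m \<rho> dst =
    (let bucket = m * batch_size p2 m
     in loop ((m\<^sup>2) ^ (c - 1)) (\<lambda>j.
          getRange Aux2 (j * bucket) bucket ;;
          distribute E \<rho> (\<lambda>pos. pos mod m\<^sup>2) bucket (m\<^sup>2) 1 ;;
          putRange dst (j * m\<^sup>2)))"

definition shuffle_pass ::
    "('v, 'ct) scheme \<Rightarrow> real \<Rightarrow> real \<Rightarrow> nat \<Rightarrow> nat \<Rightarrow> (nat \<Rightarrow> nat) \<Rightarrow> arr \<Rightarrow> arr \<Rightarrow> ('v, 'ct) prog"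
  where
  "shuffle_pass E p1 p2 c m \<rho> src dst =
     loop (c - 1) (\<lambda>i. level E p1 p2 c m \<rho> src (i + 1)) ;;
     clean_up E p2 c m \<rho> dst"

definition start_state :: "(arr \<Rightarrow> 'ct list) \<Rightarrow> ('v, 'ct) state" where
  "start_state srv = \<lparr>server = srv, received = [], batches = [], sealed = [], coin = 0,
     failed = False, messages = [], user_work = 0, server_work = 0,
     user_peak = 0, server_peak = storage_size srv\<rparr>"

definition melbourne_run ::
    "('v, 'ct) scheme \<Rightarrow> real \<Rightarrow> real \<Rightarrow> nat \<Rightarrow> nat \<Rightarrow> (arr \<Rightarrow> 'ct list) \<Rightarrow>
     (nat \<Rightarrow> nat) \<Rightarrow> (nat \<Rightarrow> nat) \<Rightarrow> ('v, 'ct) state" where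
  "melbourne_run E p1 p2 c m srv \<pi>\<^sub>1 \<pi> =
     (shuffle_pass E p1 p2 c m \<pi>\<^sub>1 In Mid ;; shuffle_pass E p1 p2 c m \<pi> Mid Out) (start_state srv)"

text \<open>The distribution of the final state, over the random choice of the first permutation.\<close>

definition melbourne_shuffle ::
    "('v, 'ct) scheme \<Rightarrow> real \<Rightarrow> real \<Rightarrow> nat \<Rightarrow> nat \<Rightarrow> (arr \<Rightarrow> 'ct list) \<Rightarrow>
     (nat \<Rightarrow> nat) \<Rightarrow> ('v, 'ct) state pmf" where
  "melbourne_shuffle E p1 p2 c m srv \<pi> =
     map_pmf (\<lambda>\<pi>\<^sub>1. melbourne_run E p1 p2 c m srv \<pi>\<^sub>1 \<pi>)
       (pmf_of_set {\<pi>\<^sub>1. \<pi>\<^sub>1 permutes {1..m ^ (2 * c)}})"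

definition shuffle_input :: "nat \<Rightarrow> (nat \<times> 'v) list \<Rightarrow> bool" where
  "shuffle_input n xs \<longleftrightarrow>
     length xs = n \<and> distinct (map fst xs) \<and> fst ` set xs \<subseteq> {1..n}"

text \<open>
  The server initially holds the encrypted input \<open>xs\<close>; the other arrays have the sizes the
  shuffle needs and arbitrary contents.
\<close>

definition initial_server ::
    "('v, 'ct) scheme \<Rightarrow> real \<Rightarrow> real \<Rightarrow> nat \<Rightarrow> nat \<Rightarrow> (nat \<times> 'v) list \<Rightarrow> (arr \<Rightarrow> 'ct list) \<Rightarrow> bool"
  where
  "initial_server E p1 p2 c m xs srv \<longleftrightarrow>
     map (dec E) (srv In) = map (\<lambda>(x, v). Real x v) xs \<and>
     length (srv Mid) = m ^ (2 * c) \<and>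
     length (srv Out) = m ^ (2 * c) \<and>
     length (srv Aux1) = (m\<^sup>2) ^ (c - 1) * (m * batch_size p1 m) \<and>
     length (srv Aux2) = (m\<^sup>2) ^ (c - 1) * (m * batch_size p2 m)"

end

(*
  The bounds hold for every choice of the first permutation and also for runs that stop early,
  because the program enforces the batch sizes b1 and b2 and its loops do not depend on the data.
  With M = m (b1 + b2) = O(n^(1/c)), handling one bucket takes two operations and O(M) steps and
  never holds more than 2 M elements in private memory.  A level handles at most 2 N buckets,
  where N = n^((c-1)/c), so two passes of c - 1 levels and a clean-up need O(c N)
  operations and O(c N M) = O(c n) steps.  Writing never changes the length of an array, so the
  storage stays at its initial size; and each step of the server is matched by a step of the user.
*)
theory Submission
  imports Defs
begin

section \<open>A cost logic for programs\<close>

text \<open>Collects the bounds that hold at every moment, failed runs included; operation count and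
  user work grow along a run and are left to \<open>costs\<close>. Current and peak private size
  both occur because \<open>update_peaks\<close> takes their maximum. Server work is compared with
  user work only, so one work count serves for both.\<close>

definition within_limits :: "nat \<Rightarrow> nat \<Rightarrow> ('v, 'ct) state \<Rightarrow> bool" where
  "within_limits S Z s \<longleftrightarrow> private_size s \<le> Z \<and> storage_size (server s) = S \<and>
     user_peak s \<le> Z \<and> server_peak s \<le> S \<and> server_work s \<le> user_work s \<and>
     (\<forall>len \<in> set (messages s). len \<le> Z)"

type_synonym ('v, 'ct) memory_pred =
  "'ct list \<Rightarrow> 'v cell list list \<Rightarrow> 'ct list list \<Rightarrow> bool"

text \<open>Pre- and postcondition concern only the private memory: received, batches, sealed.\<close>

definition costs ::
    "nat \<Rightarrow> nat \<Rightarrow> ('v, 'ct) memory_pred \<Rightarrow> ('v, 'ct) prog \<Rightarrow> ('v, 'ct) memory_pred \<Rightarrow>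
     nat \<Rightarrow> nat \<Rightarrow> bool" where
  "costs S Z P p Q t w \<longleftrightarrow> (\<forall>s. within_limits S Z s \<longrightarrow> P (received s) (batches s) (sealed s) \<longrightarrow>
     within_limits S Z (p s) \<and>
     num_operations (p s) \<le> num_operations s + t \<and>
     user_work (p s) \<le> user_work s + w \<and>
     (\<not> failed (p s) \<longrightarrow> Q (received (p s)) (batches (p s)) (sealed (p s))))"

lemma costsI:
  assumes "\<And>s. within_limits S Z s \<Longrightarrow> P (received s) (batches s) (sealed s) \<Longrightarrow>
     within_limits S Z (p s) \<and>
     num_operations (p s) \<le> num_operations s + t \<and>
     user_work (p s) \<le> user_work s + w \<and>
     (\<not> failed (p s) \<longrightarrow> Q (received (p s)) (batches (p s)) (sealed (p s)))"
  shows "costs S Z P p Q t w"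
  using assms unfolding costs_def by blast

lemma costs_weaken:
  assumes "costs S Z P p Q t w" "t \<le> t'" "w \<le> w'"
    and "\<And>r B C. P' r B C \<Longrightarrow> P r B C" "\<And>r B C. Q r B C \<Longrightarrow> Q' r B C"
  shows "costs S Z P' p Q' t' w'"
  using assms unfolding costs_def by (meson add_left_mono order_trans)

lemma costs_mono:
  assumes "costs S Z P p Q t w" "t \<le> t'" "w \<le> w'"
  shows "costs S Z P p Q t' w'"
  by (rule costs_weaken[OF assms])

text \<open>If \<open>p\<close> fails, \<open>q\<close> is skipped and the bounds for
  \<open>p\<close> suffice, which is why \<open>costs\<close> promises \<open>Q\<close> only for a
  run that has not failed. Otherwise \<open>Q\<close> is what \<open>q\<close> starts from.\<close>

lemma costs_seq:
  assumes p: "costs S Z P p Q t w" and q: "costs S Z Q q R t' w'"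
  shows "costs S Z P (p ;; q) R (t + t') (w + w')"
proof (rule costsI)
  fix s assume s: "within_limits S Z s" "P (received s) (batches s) (sealed s)"
  note * = p[unfolded costs_def, rule_format, OF s]
  show "within_limits S Z ((p ;; q) s) \<and>
     num_operations ((p ;; q) s) \<le> num_operations s + (t + t') \<and>
     user_work ((p ;; q) s) \<le> user_work s + (w + w') \<and>
     (\<not> failed ((p ;; q) s) \<longrightarrow>
       R (received ((p ;; q) s)) (batches ((p ;; q) s)) (sealed ((p ;; q) s)))"
  proof (cases "failed (p s)")
    case True
    then show ?thesis using * by (simp add: seq_def)
  next
    case False
    then have "Q (received (p s)) (batches (p s)) (sealed (p s))" using * by blast
    from q[unfolded costs_def, rule_format, OF _ this] * False
    show ?thesis by (simp add: seq_def)
  qed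
qed

text \<open>The old bound on the private size is available as a premise so that the idle step of the
  loop counter is covered for an arbitrary \<open>P\<close>.\<close>

lemma costs_user_step:
  assumes "\<And>s. P (received s) (batches s) (sealed s) \<Longrightarrow> private_size s \<le> Z \<Longrightarrow>
    private_size (f s) \<le> Z \<and>
    server (f s) = server s \<and> user_peak (f s) = user_peak s \<and> server_peak (f s) = server_peak s \<and>
    server_work (f s) = server_work s \<and> user_work (f s) = user_work s \<and>
    messages (f s) = messages s \<and> Q (received (f s)) (batches (f s)) (sealed (f s))"
  shows "costs S Z P (user_step w f) Q 0 w"
proof (rule costsI)
  fix s assume s: "within_limits S Z s" "P (received s) (batches s) (sealed s)"
  then have "private_size s \<le> Z" by (simp add: within_limits_def)
  from assms[OF s(2) this] s(1)
  show "within_limits S Z (user_step w f s) \<and>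
     num_operations (user_step w f s) \<le> num_operations s + 0 \<and>
     user_work (user_step w f s) \<le> user_work s + w \<and>
     (\<not> failed (user_step w f s) \<longrightarrow> Q (received (user_step w f s)) (batches (user_step w f s))
        (sealed (user_step w f s)))"
    by (simp add: user_step_def update_peaks_def within_limits_def num_operations_def
        private_size_def Let_def)
qed

text \<open>\<open>P\<close> is the loop invariant. The additional step per round pays for the loop
  counter.\<close>

lemma costs_loop:
  assumes "\<And>k. k < N \<Longrightarrow> costs S Z P (body k) P t w"
  shows "costs S Z P (loop N body) P (N * t) (N * (w + 1))"
  using assms
proof (induction N)
  case 0
  show ?case by (rule costsI) simp
next
  case (Suc N)
  have step: "costs S Z P (user_step 1 id) P 0 1"
    by (rule costs_user_step) simp
  have "costs S Z P (loop N body) P (N * t) (N * (w + 1))"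
    using Suc by simp
  from costs_seq[OF this costs_seq[OF step Suc.prems[of N]]]
  show ?case by (simp add: algebra_simps)
qed

section \<open>Cost of processing one bucket\<close>

text \<open>Describes the memory between two buckets. What remains in \<open>received\<close> and
  \<open>batches\<close> need not be shown to be empty: the next read and the next
  \<open>open_batches\<close> overwrite it. Size at most M for each gives the limit 2 * M.\<close>

definition idle :: "nat \<Rightarrow> ('v, 'ct) memory_pred" where
  "idle M r B C \<longleftrightarrow> length r \<le> M \<and> sum_list (map length B) \<le> M \<and> C = []"

text \<open>The bound is on each pair of an open batch and its sealed part, since sealing moves
  cells from one to the other. Thus all batches together still fit into K * b cells.\<close>

definition sealing :: "nat \<Rightarrow> nat \<Rightarrow> nat \<Rightarrow> ('v, 'ct) memory_pred" where
  "sealing M K b r B C \<longleftrightarrow> length r \<le> M \<and> length B = K \<and> length C = K \<and>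
     (\<forall>k < K. length (B ! k) + length (C ! k) \<le> b)"

definition filling :: "nat \<Rightarrow> nat \<Rightarrow> nat \<Rightarrow> ('v, 'ct) memory_pred" where
  "filling M K b r B C \<longleftrightarrow> sealing M K b r B C \<and> C = replicate K []"

lemma filling_imp_sealing: "filling M K b r B C \<Longrightarrow> sealing M K b r B C"
  unfolding filling_def by blast

lemma sealing_size:
  assumes "sealing M K b r B C" "K * b \<le> M"
  shows "sum_list (map length B) + sum_list (map length C) \<le> M"
proof -
  have "sum_list (map length B) + sum_list (map length C)
      = (\<Sum>k<K. length (B ! k) + length (C ! k))"
    using assms(1)
    by (simp add: sealing_def sum_list_sum_nth sum.distrib atLeast0LessThan)
  also have "\<dots> \<le> (\<Sum>k<K. b)"
    using assms(1) by (intro sum_mono) (simp add: sealing_def)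
  finally show ?thesis using assms(2) by simp
qed

lemma sealing_private_size:
  assumes "sealing M K b (received s) (batches s) (sealed s)" "K * b \<le> M"
  shows "private_size s \<le> 2 * M"
  using sealing_size[OF assms] assms(1) by (simp add: private_size_def sealing_def)

section \<open>Exchanges between user and server\<close>

lemma length_write_range: "length (write_range w xs) = length xs"
  by (simp add: write_range_def)

lemma length_fold_write_range: "length (fold write_range ws xs) = length xs"
  by (induction ws arbitrary: xs) (simp_all add: length_write_range)

lemma storage_size_write:
  "storage_size (srv(a := fold write_range ws (srv a))) = storage_size srv"
  unfolding storage_size_def
  by (rule sum.cong) (simp_all add: length_fold_write_range)

lemma costs_getRange:
  assumes "len \<le> M"
  shows "costs S (2 * M) (idle M) (getRange a start len) (idle M) 1 M"
proof -
  \<comment> \<open>Reading past the end of an array truncates, so only an upper bound on the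
    message holds.\<close>
  have *: "length (read_range xs (start, len)) \<le> M" for xs :: "'ct list"
    using assms by (simp add: read_range_def)
  show ?thesis
  proof (rule costsI)
    fix s :: "('v, 'ct) state"
    assume s: "within_limits S (2 * M) s" "idle M (received s) (batches s) (sealed s)"
    show "within_limits S (2 * M) (getRange a start len s) \<and>
      num_operations (getRange a start len s) \<le> num_operations s + 1 \<and>
      user_work (getRange a start len s) \<le> user_work s + M \<and>
      (\<not> failed (getRange a start len s) \<longrightarrow> idle M (received (getRange a start len s))
         (batches (getRange a start len s)) (sealed (getRange a start len s)))"
      using s *[of "server s a"]
      by (auto simp: getRange_def getRangeDist_def exchange_def update_peaks_def
          within_limits_def num_operations_def private_size_def idle_def Let_def)
  qed
qed

text \<open>Common core of the two ways of writing. It speaks of a single state because the list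
  \<open>ws\<close> is computed from the sealed batches of that state. The message consists of these
  batches, hence has at most M cells, and they leave the memory.\<close>

lemma costs_put_ranges:
  assumes s: "within_limits S (2 * M) s" "sealing M K b (received s) (batches s) (sealed s)"
    and M: "K * b \<le> M"
    and ws: "sum_list (map (length \<circ> snd) ws) = sum_list (map length (sealed s))"
    and s': "s' = put_ranges a ws s"
  shows "within_limits S (2 * M) s' \<and> num_operations s' \<le> num_operations s + 1 \<and>
     user_work s' \<le> user_work s + M \<and>
     (\<not> failed s' \<longrightarrow> idle M (received s') (batches s') (sealed s'))"
  using s sealing_size[OF s(2) M] ws unfolding s'
  by (auto simp: put_ranges_def exchange_def update_peaks_def within_limits_def
      num_operations_def private_size_def idle_def sealing_def Let_def storage_size_write)

lemma costs_putRangeDist: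
  assumes "K * b \<le> M"
  shows "costs S (2 * M) (sealing M K b) (putRangeDist a start) (idle M) 1 M"
proof (rule costsI, rule costs_put_ranges[OF _ _ assms])
  fix s :: "('v, 'ct) state"
  have "map (length \<circ> snd) (map (\<lambda>k. (start k, sealed s ! k)) [0..<length (sealed s)])
      = map length (map (\<lambda>k. sealed s ! k) [0..<length (sealed s)])"
    by simp
  then show "sum_list (map (length \<circ> snd)
      (map (\<lambda>k. (start k, sealed s ! k)) [0..<length (sealed s)])) =
      sum_list (map length (sealed s))"
    by (simp only: map_nth)
  show "putRangeDist a start s = put_ranges a
      (map (\<lambda>k. (start k, sealed s ! k)) [0..<length (sealed s)]) s"
    by (simp add: putRangeDist_def)
qed

lemma costs_putRange:
  assumes "K * b \<le> M"
  shows "costs S (2 * M) (sealing M K b) (putRange a start) (idle M) 1 M"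
proof (rule costsI, rule costs_put_ranges[OF _ _ assms])
  fix s :: "('v, 'ct) state"
  show "sum_list (map (length \<circ> snd) [(start, concat (sealed s))]) =
      sum_list (map length (sealed s))"
    by (simp add: length_concat)
  show "putRange a start s = put_ranges a [(start, concat (sealed s))] s"
    by (simp add: putRange_def)
qed

section \<open>Local steps in the private memory\<close>

lemma costs_open_batches:
  assumes "K * b \<le> M"
  shows "costs S (2 * M) (idle M) (open_batches K) (filling M K b) 0 K"
  unfolding open_batches_def
  by (rule costs_user_step)
    (simp add: idle_def filling_def sealing_def private_size_def sum_list_replicate)

text \<open>Unlike in \<open>costs_user_step\<close>, the update and its cost may depend on the
  state, as the case distinctions of \<open>route\<close> require. The size limit now follows from
  \<open>sealing\<close>.\<close>

lemma costs_memory_step: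
  assumes M: "K * b \<le> M"
    and step: "\<And>s. P (received s) (batches s) (sealed s) \<Longrightarrow> \<exists>v f. p s = user_step v f s \<and> v \<le> w \<and>
      sealing M K b (received (f s)) (batches (f s)) (sealed (f s)) \<and>
      Q (received (f s)) (batches (f s)) (sealed (f s)) \<and>
      server (f s) = server s \<and> user_peak (f s) = user_peak s \<and>
      server_peak (f s) = server_peak s \<and> server_work (f s) = server_work s \<and>
      user_work (f s) = user_work s \<and> messages (f s) = messages s"
  shows "costs S (2 * M) P p Q 0 w"
proof (rule costsI)
  fix s assume s: "within_limits S (2 * M) s" "P (received s) (batches s) (sealed s)"
  obtain v f where f: "p s = user_step v f s" "v \<le> w"
      "sealing M K b (received (f s)) (batches (f s)) (sealed (f s))"
      "Q (received (f s)) (batches (f s)) (sealed (f s))"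
      "server (f s) = server s" "user_peak (f s) = user_peak s"
      "server_peak (f s) = server_peak s" "server_work (f s) = server_work s"
      "user_work (f s) = user_work s" "messages (f s) = messages s"
    using step[OF s(2)] by blast
  have "private_size (f s) \<le> 2 * M"
    by (rule sealing_private_size[OF f(3) M])
  then show "within_limits S (2 * M) (p s) \<and> num_operations (p s) \<le> num_operations s + 0 \<and>
     user_work (p s) \<le> user_work s + w \<and>
     (\<not> failed (p s) \<longrightarrow> Q (received (p s)) (batches (p s)) (sealed (p s)))"
    using s(1) f
    by (simp add: user_step_def update_peaks_def within_limits_def num_operations_def
        private_size_def Let_def)
qed

text \<open>Only \<open>j\<close> has to be in range: an update at \<open>k\<close> outside the list
  changes nothing, and such a \<open>k\<close> differs from \<open>j\<close>. This matters because
  \<open>route\<close> is analysed for arbitrary \<open>idx\<close> and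
  \<open>\<rho>\<close>.\<close>

lemma nth_update_within:
  "j < length xs \<Longrightarrow> xs[k := x] ! j = (if k = j then x else xs ! j)"
  by (cases "k = j") simp_all

lemma costs_route:
  fixes E :: "('v, 'ct) scheme"
  assumes "K * b \<le> M"
  shows "costs S (2 * M) (filling M K b) (route E \<rho> idx b) (filling M K b) 0 7"
proof (rule costs_memory_step[OF assms])
  fix s :: "('v, 'ct) state"
  assume s: "filling M K b (received s) (batches s) (sealed s)"
  let ?goal = "\<lambda>v f. route E \<rho> idx b s = user_step v f s \<and> v \<le> 7 \<and>
      sealing M K b (received (f s)) (batches (f s)) (sealed (f s)) \<and>
      filling M K b (received (f s)) (batches (f s)) (sealed (f s)) \<and>
      server (f s) = server s \<and> user_peak (f s) = user_peak s \<and>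
      server_peak (f s) = server_peak s \<and> server_work (f s) = server_work s \<and>
      user_work (f s) = user_work s \<and> messages (f s) = messages s"
  show "\<exists>v f. ?goal v f"
  proof (cases "received s")
    case Nil
    then have "?goal 1 id" using s by (auto simp: route_def filling_def)
    then show ?thesis by blast
  next
    case (Cons y ys)
    show ?thesis
    proof (cases "dec E y")
      case Dummy
      then have "?goal 3 (\<lambda>s. s\<lparr>received := ys\<rparr>)"
        using Cons s by (auto simp: route_def filling_def sealing_def)
      then show ?thesis by blast
    next
      case (Real x v)
      define k where "k = idx (\<rho> x - 1)"
      show ?thesis
      proof (cases "length (batches s ! k) < b")
        case True
        then have "?goal 7 (\<lambda>s. s\<lparr>received := ys,
            batches := (batches s)[k := batches s ! k @ [Real x v]]\<rparr>)"
          using Cons Real s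
          by (auto simp: route_def filling_def sealing_def k_def nth_update_within
              user_step_def Let_def)
        then show ?thesis by blast
      next
        case False
        \<comment> \<open>The memory predicates do not mention the failure flag, so overflow leaves
          the invariant intact.\<close>
        then have "?goal 6 (\<lambda>s. s\<lparr>failed := True\<rparr>)"
          using Cons Real s by (auto simp: route_def filling_def k_def Let_def)
        then show ?thesis by blast
      qed
    qed
  qed
qed

lemma costs_pad:
  assumes "K * b \<le> M"
  shows "costs S (2 * M) (filling M K b) (pad b k) (filling M K b) 0 2"
  unfolding pad_def
  by (rule costs_memory_step[OF assms], intro exI conjI, rule refl)
    (auto simp: filling_def sealing_def nth_update_within)

lemma costs_seal:
  fixes E :: "('v, 'ct) scheme"
  assumes "K * b \<le> M" "k < K"
  shows "costs S (2 * M) (sealing M K b) (seal E k) (sealing M K b) 0 3"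
proof (rule costs_memory_step[OF assms(1)])
  fix s :: "('v, 'ct) state"
  assume s: "sealing M K b (received s) (batches s) (sealed s)"
  let ?f = "\<lambda>s. case batches s ! k of
      [] \<Rightarrow> s
    | y # ys \<Rightarrow> s\<lparr>batches := (batches s)[k := ys],
                  sealed := (sealed s)[k := sealed s ! k @ [enc E (coin s) y]],
                  coin := Suc (coin s)\<rparr>"
  have "sealing M K b (received (?f s)) (batches (?f s)) (sealed (?f s))"
    using s by (cases "batches s ! k") (fastforce simp: sealing_def nth_update_within)+
  then show "\<exists>v f. seal E k s = user_step v f s \<and> v \<le> 3 \<and>
      sealing M K b (received (f s)) (batches (f s)) (sealed (f s)) \<and>
      sealing M K b (received (f s)) (batches (f s)) (sealed (f s)) \<and>
      server (f s) = server s \<and> user_peak (f s) = user_peak s \<and>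
      server_peak (f s) = server_peak s \<and> server_work (f s) = server_work s \<and>
      user_work (f s) = user_work s \<and> messages (f s) = messages s"
    by (intro exI[of _ 3] exI[of _ ?f]) (simp add: seal_def split: list.split)
qed

section \<open>Total for one bucket\<close>

lemma costs_distribute:
  fixes E :: "('v, 'ct) scheme"
  assumes L: "L \<le> M" and Kb: "K * b \<le> M" and K: "K \<le> M"
  shows "costs S (2 * M) (idle M) (distribute E \<rho> idx L K b) (sealing M K b) 0 (18 * M)"
proof -
  have route: "costs S (2 * M) (filling M K b) (loop L (\<lambda>_. route E \<rho> idx b)) (filling M K b)
      (L * 0) (L * (7 + 1))"
    by (intro costs_loop costs_route Kb)
  have pad: "costs S (2 * M) (filling M K b) (loop K (\<lambda>k. loop b (\<lambda>_. pad b k)))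
      (filling M K b) (K * (b * 0)) (K * (b * (2 + 1) + 1))"
    by (intro costs_loop costs_pad Kb)
  have seal: "costs S (2 * M) (sealing M K b) (loop K (\<lambda>k. loop b (\<lambda>_. seal E k)))
      (sealing M K b) (K * (b * 0)) (K * (b * (3 + 1) + 1))"
    by (intro costs_loop costs_seal Kb)
  \<comment> \<open>Sealing breaks \<open>filling\<close>, whose sealed parts are all empty, so the
    last loop runs under the weaker invariant.\<close>
  have seal': "costs S (2 * M) (filling M K b) (loop K (\<lambda>k. loop b (\<lambda>_. seal E k)))
      (sealing M K b) (K * (b * 0)) (K * (b * (3 + 1) + 1))"
    by (rule costs_weaken[OF seal]) (simp_all add: filling_imp_sealing)
  \<comment> \<open>Routing costs 7 + 1 per received cell. Padding and sealing cost 2 + 1 and 3 + 1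
    per batch cell. Opening and the two outer loops cost 3 per batch. With L, K and K * b at most M
    this gives 8 + 3 + 7 = 18.\<close>
  have "K + (L * (7 + 1) + (K * (b * (2 + 1) + 1) + K * (b * (3 + 1) + 1)))
      = 8 * L + 3 * K + 7 * (K * b)"
    by (simp add: algebra_simps)
  also have "\<dots> \<le> 18 * M" using assms by linarith
  finally have w: "K + (L * (7 + 1) + (K * (b * (2 + 1) + 1) + K * (b * (3 + 1) + 1)))
      \<le> 18 * M" .
  show ?thesis unfolding distribute_def
    by (rule costs_mono[OF costs_seq[OF costs_open_batches[OF Kb]
            costs_seq[OF route costs_seq[OF pad seal']]] _ w]) simp
qed

lemma costs_bucket:
  fixes E :: "('v, 'ct) scheme"
  assumes L: "L \<le> M" and Kb: "K * b \<le> M" and K: "K \<le> M"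
    and put: "costs S (2 * M) (sealing M K b) put (idle M) 1 M"
  shows "costs S (2 * M) (idle M) (getRange a start L ;; distribute E \<rho> idx L K b ;; put)
    (idle M) 2 (20 * M)"
  by (rule costs_mono[OF costs_seq[OF costs_getRange[OF L]
          costs_seq[OF costs_distribute[OF L Kb K] put]]]) simp_all

section \<open>Cost of the shuffle\<close>

text \<open>The number of blocks times the number of buckets per block is (m^2)^(c-1) at every
  level. The second phase handles no more buckets than the first, and two operations per bucket give
  the factor 4.\<close>

lemma costs_level:
  fixes E :: "('v, 'ct) scheme"
  assumes i: "1 \<le> i" "i < c" and m: "m \<ge> 1"
    and M: "m * batch_size p1 m \<le> M" "m * batch_size p2 m \<le> M" "m\<^sup>2 \<le> M"
  shows "costs S (2 * M) (idle M) (level E p1 p2 c m \<rho> src i) (idle M)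
    (4 * (m\<^sup>2) ^ (c - 1)) (44 * ((m\<^sup>2) ^ (c - 1) * M))"
proof -
  define nb where "nb = (m\<^sup>2) ^ (c - i)"
  define w where "w = 20 * M + 1"
  have m_sq: "m \<le> m\<^sup>2" using m by (simp add: self_le_power)
  then have mM: "m \<le> M" using M(3) by linarith
  note m_sq
  \<comment> \<open>Here i < c enters: a block has at least m^2 buckets, so the loop over m chunks
    has negligible overhead.\<close>
  also have "m\<^sup>2 \<le> nb"
    using i m by (simp add: nb_def self_le_power)
  finally have m_nb: "m \<le> nb" .
  have M1: "M \<ge> 1" using mM m by linarith
  have N: "(m\<^sup>2) ^ (i - 1) * nb = (m\<^sup>2) ^ (c - 1)"
    unfolding nb_def power_add[symmetric]
    by (rule arg_cong[where f = "power (m\<^sup>2)"]) (use i in linarith)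
  \<comment> \<open>\<open>L\<close> is left open because buckets have m^2 cells at level 1 and m *
    b2 cells later.\<close>
  have first: "costs S (2 * M) (idle M) (loop nb (\<lambda>t. getRange a (start t) L ;;
      distribute E \<rho> idx L m (batch_size p1 m) ;; putRangeDist Aux1 (dest t)))
      (idle M) (nb * 2) (nb * (20 * M + 1))" if "L \<le> M" for a start L idx dest
    by (rule costs_loop, rule costs_bucket[OF that M(1) mM costs_putRangeDist[OF M(1)]])
  have second: "costs S (2 * M) (idle M) (loop m (\<lambda>k. loop (nb div m) (\<lambda>q.
      getRange Aux1 (start k q) (m * batch_size p1 m) ;;
      distribute E \<rho> idx (m * batch_size p1 m) m (batch_size p2 m) ;;
      putRangeDist Aux2 (dest k q))))
      (idle M) (m * (nb div m * 2)) (m * (nb div m * (20 * M + 1) + 1))" for start idx dest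
    by (rule costs_loop, rule costs_loop,
        rule costs_bucket[OF M(1) M(2) mM costs_putRangeDist[OF M(2)]])
  have body: "costs S (2 * M) (idle M) (level E p1 p2 c m \<rho> src i) (idle M)
    ((m\<^sup>2) ^ (i - 1) * (nb * 2 + m * (nb div m * 2)))
    ((m\<^sup>2) ^ (i - 1) * (nb * (20 * M + 1) + m * (nb div m * (20 * M + 1) + 1) + 1))"
    unfolding level_def Let_def nb_def[symmetric]
    by (rule costs_loop, rule costs_seq[OF first second]) (use M in simp)
  have div: "m * (nb div m) \<le> nb" by simp
  have "nb * 2 + m * (nb div m * 2) \<le> 4 * nb" using div by linarith
  then have "(m\<^sup>2) ^ (i - 1) * (nb * 2 + m * (nb div m * 2)) \<le> (m\<^sup>2) ^ (i - 1) * (4 * nb)"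
    by (rule mult_left_mono) simp
  also have "\<dots> = 4 * (m\<^sup>2) ^ (c - 1)" unfolding N[symmetric] by simp
  finally have t: "(m\<^sup>2) ^ (i - 1) * (nb * 2 + m * (nb div m * 2)) \<le> 4 * (m\<^sup>2) ^ (c - 1)" .
  \<comment> \<open>The term m + 1 counts the rounds of the chunk loop and the one of the block
    loop. It is at most 2 * nb, and the two summands 1 inside \<open>w\<close> add another 2 * nb,
    so 40 becomes 44.\<close>
  have "nb * w + m * (nb div m * w + 1) + 1 = nb * w + m * (nb div m) * w + (m + 1)"
    by (simp add: algebra_simps)
  also have "\<dots> \<le> nb * w + nb * w + 2 * nb"
    using m m_nb by (intro add_mono mult_right_mono div) simp_all
  also have "\<dots> = 40 * (nb * M) + 4 * nb" by (simp add: w_def algebra_simps)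
  also have "\<dots> \<le> 44 * (nb * M)" using M1 by simp
  finally have "(m\<^sup>2) ^ (i - 1) * (nb * w + m * (nb div m * w + 1) + 1)
      \<le> (m\<^sup>2) ^ (i - 1) * (44 * (nb * M))"
    by (rule mult_left_mono) simp
  also have "\<dots> = 44 * ((m\<^sup>2) ^ (c - 1) * M)" unfolding N[symmetric] by simp
  finally show ?thesis
    unfolding w_def by (rule costs_mono[OF body t])
qed

text \<open>Sorting a bucket is one more distribution, now with m^2 batches of size 1, so the bucket
  bound applies unchanged.\<close>

lemma costs_clean_up:
  fixes E :: "('v, 'ct) scheme"
  assumes m: "m \<ge> 1" and M: "m * batch_size p2 m \<le> M" "m\<^sup>2 \<le> M"
  shows "costs S (2 * M) (idle M) (clean_up E p2 c m \<rho> dst) (idle M)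
    (2 * (m\<^sup>2) ^ (c - 1)) (21 * ((m\<^sup>2) ^ (c - 1) * M))"
proof -
  have "1 \<le> m\<^sup>2" using m by simp
  then have "1 \<le> M" using M(2) by linarith
  then have w: "(m\<^sup>2) ^ (c - 1) * (20 * M + 1) \<le> 21 * ((m\<^sup>2) ^ (c - 1) * M)"
    by (simp add: algebra_simps)
  have "costs S (2 * M) (idle M) (clean_up E p2 c m \<rho> dst) (idle M)
    ((m\<^sup>2) ^ (c - 1) * 2) ((m\<^sup>2) ^ (c - 1) * (20 * M + 1))"
    unfolding clean_up_def Let_def
    by (intro costs_loop costs_bucket costs_putRange) (use M in simp_all)
  from costs_mono[OF this _ w] show ?thesis by simp
qed

lemma costs_shuffle_pass:
  fixes E :: "('v, 'ct) scheme"
  assumes c: "c \<ge> 1" and m: "m \<ge> 1"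
    and M: "m * batch_size p1 m \<le> M" "m * batch_size p2 m \<le> M" "m\<^sup>2 \<le> M"
  shows "costs S (2 * M) (idle M) (shuffle_pass E p1 p2 c m \<rho> src dst) (idle M)
    (4 * c * (m\<^sup>2) ^ (c - 1)) (45 * c * ((m\<^sup>2) ^ (c - 1) * M))"
proof -
  define N where "N = (m\<^sup>2) ^ (c - 1)"
  have "1 \<le> m\<^sup>2" using m by simp
  then have "1 \<le> M" using M(3) by linarith
  then have NM: "1 \<le> N * M" using m by (simp add: N_def)
  obtain d where d: "c = Suc d" using c by (cases c) auto
  have pass: "costs S (2 * M) (idle M) (shuffle_pass E p1 p2 c m \<rho> src dst) (idle M)
      ((c - 1) * (4 * N) + 2 * N) ((c - 1) * (44 * (N * M) + 1) + 21 * (N * M))"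
    unfolding shuffle_pass_def N_def
    by (rule costs_seq[OF costs_loop[OF costs_level[OF _ _ m M]] costs_clean_up[OF m M(2,3)]])
      simp_all
  \<comment> \<open>The loop counter raises 44 to 45 per level; the cheaper clean-up is then charged
    as a c-th level.\<close>
  have "(c - 1) * (44 * (N * M) + 1) \<le> (c - 1) * (45 * (N * M))"
    using NM by (intro mult_left_mono) simp_all
  then have "(c - 1) * (44 * (N * M) + 1) + 21 * (N * M) \<le> (c - 1) * (45 * (N * M)) + 21 * (N * M)"
    by (rule add_right_mono)
  also have "\<dots> \<le> 45 * c * (N * M)" by (simp add: d algebra_simps)
  finally have w: "(c - 1) * (44 * (N * M) + 1) + 21 * (N * M) \<le> 45 * c * (N * M)" .
  have t: "(c - 1) * (4 * N) + 2 * N \<le> 4 * c * N" by (simp add: d algebra_simps)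
  show ?thesis using costs_mono[OF pass t w] unfolding N_def .
qed

lemma melbourne_run_limits:
  assumes c: "c \<ge> 1" and m: "m \<ge> 1"
    and M: "m * batch_size p1 m \<le> M" "m * batch_size p2 m \<le> M" "m\<^sup>2 \<le> M"
    and s: "s = melbourne_run E p1 p2 c m srv \<pi>\<^sub>1 \<pi>"
  shows "within_limits (storage_size srv) (2 * M) s"
    and "num_operations s \<le> 8 * c * (m\<^sup>2) ^ (c - 1)"
    and "user_work s \<le> 90 * c * ((m\<^sup>2) ^ (c - 1) * M)"
proof -
  have start: "within_limits (storage_size srv) (2 * M) (start_state srv)"
    "idle M (received (start_state srv)) (batches (start_state srv)) (sealed (start_state srv))"
    "num_operations (start_state srv) = 0" "user_work (start_state srv) = 0"
    by (simp_all add: within_limits_def start_state_def private_size_def num_operations_def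
        idle_def)
  note pass = costs_shuffle_pass[OF c m M]
  have "costs (storage_size srv) (2 * M) (idle M)
      (shuffle_pass E p1 p2 c m \<pi>\<^sub>1 In Mid ;; shuffle_pass E p1 p2 c m \<pi> Mid Out) (idle M)
      (4 * c * (m\<^sup>2) ^ (c - 1) + 4 * c * (m\<^sup>2) ^ (c - 1))
      (45 * c * ((m\<^sup>2) ^ (c - 1) * M) + 45 * c * ((m\<^sup>2) ^ (c - 1) * M))"
    by (rule costs_seq[OF pass pass])
  note run = this[unfolded costs_def, rule_format, OF start(1,2),
      folded melbourne_run_def, folded s, unfolded start(3,4)]
  show "within_limits (storage_size srv) (2 * M) s"
    using run by blast
  show "num_operations s \<le> 8 * c * (m\<^sup>2) ^ (c - 1)"
    using run by simp
  show "user_work s \<le> 90 * c * ((m\<^sup>2) ^ (c - 1) * M)"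
    using run by (simp add: mult_ac)
qed

section \<open>From batch sizes to powers of n\<close>

lemma le_batch_size: "p > 1 \<Longrightarrow> m \<le> batch_size p m"
proof -
  assume "p > 1"
  then have "real m \<le> p * real m" using mult_right_mono[of 1 p "real m"] by simp
  also have "\<dots> \<le> real_of_int \<lceil>p * real m\<rceil>" by (rule le_of_int_ceiling)
  finally have "int m \<le> \<lceil>p * real m\<rceil>" by linarith
  then show ?thesis by (simp add: batch_size_def le_nat_iff)
qed

text \<open>Rounding up adds at most 1, which is at most m.\<close>

lemma batch_size_le:
  assumes "p > 1" "m \<ge> 1"
  shows "real (batch_size p m) \<le> (p + 1) * real m"
proof -
  have "real (batch_size p m) \<le> p * real m + 1"
    using assms by (simp add: batch_size_def)
  then show ?thesis using assms(2) by (simp add: algebra_simps)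
qed

theorem theorem6p1:
  fixes p1 p2 :: real
  assumes "p1 > 1" and "p2 > 1"
  shows "\<exists>K::real. K > 0 \<and> (\<forall>(c::nat) (m::nat) (n::nat) (E :: ('v, 'ct) scheme) (xs :: (nat \<times> 'v) list)
      (srv :: arr \<Rightarrow> 'ct list) (\<pi> :: nat \<Rightarrow> nat).
    c \<ge> 3 \<longrightarrow> n \<ge> 1 \<longrightarrow> n = m ^ (2 * c) \<longrightarrow>
    correct_scheme E \<longrightarrow> shuffle_input n xs \<longrightarrow> initial_server E p1 p2 c m xs srv \<longrightarrow>
    \<pi> permutes {1..n} \<longrightarrow>
    (\<forall>s \<in> set_pmf (melbourne_shuffle E p1 p2 c m srv \<pi>).
       real (num_operations s) \<le> K * real c * real n powr ((real c - 1) / real c) \<and>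
       (\<forall>len \<in> set (messages s). real len \<le> K * real n powr (1 / real c)) \<and>
       real (user_peak s) \<le> K * real n powr (1 / real c) \<and>
       real (server_peak s) \<le> K * real n \<and>
       real (user_work s) \<le> K * real c * real n \<and>
       real (server_work s) \<le> K * real c * real n))"
proof -
  \<comment> \<open>C = (p1 + 1) + (p2 + 1) will give M <= C * m^2. The factor 90 comes from the
    user work; the other bounds need less.\<close>
  define C where "C = p1 + p2 + 2"
  have C: "C > 4" using assms by (simp add: C_def)
  show ?thesis
  proof (intro exI[of _ "90 * C"] conjI allI impI ballI)
    show "90 * C > 0" using C by simp
  next
    fix c m n :: nat and E :: "('v, 'ct) scheme" and xs :: "(nat \<times> 'v) list"
      and srv :: "arr \<Rightarrow> 'ct list" and \<pi> :: "nat \<Rightarrow> nat" and s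
    assume c: "c \<ge> 3" and n1: "n \<ge> 1" and n: "n = m ^ (2 * c)"
      and xs: "shuffle_input n xs" and srv: "initial_server E p1 p2 c m xs srv"
      and s: "s \<in> set_pmf (melbourne_shuffle E p1 p2 c m srv \<pi>)"
    \<comment> \<open>Every state in the support is the outcome of some first permutation, and the
      limits hold for all of them.\<close>
    obtain \<pi>\<^sub>1 where run: "s = melbourne_run E p1 p2 c m srv \<pi>\<^sub>1 \<pi>"
      using s by (auto simp: melbourne_shuffle_def)
    have m: "m \<ge> 1" using n1 n c by (cases m) (auto simp: power_0_left)
    define N where "N = (m\<^sup>2) ^ (c - 1)"
    define M where "M = m * batch_size p1 m + m * batch_size p2 m"
    have M: "m * batch_size p1 m \<le> M" "m * batch_size p2 m \<le> M" "m\<^sup>2 \<le> M"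
      using mult_le_mono2[OF le_batch_size[OF assms(1), of m], of m]
      unfolding M_def power2_eq_square by linarith+
    have Nm: "N * m\<^sup>2 = n"
      using c by (simp add: N_def n power_mult flip: power_Suc2)
    have "real M = real m * (real (batch_size p1 m) + real (batch_size p2 m))"
      by (simp add: M_def algebra_simps)
    also have "\<dots> \<le> real m * ((p1 + 1) * real m + (p2 + 1) * real m)"
      using batch_size_le[OF assms(1) m] batch_size_le[OF assms(2) m]
      by (intro mult_left_mono add_mono) simp_all
    finally have M_le: "real M \<le> C * real (m\<^sup>2)"
      by (simp add: C_def algebra_simps power2_eq_square)
    have "real (N * M) \<le> real N * (C * real (m\<^sup>2))"
      using M_le by (simp add: mult_left_mono)
    also have "\<dots> = C * real n" by (simp flip: Nm)
    finally have NM: "real (N * M) \<le> C * real n" .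
    \<comment> \<open>Writing n as a real power of m turns the exponents 1/c and (c-1)/c into the
      integers 2 and 2 * (c - 1).\<close>
    have "real n = real m powr real (2 * c)"
      using m by (subst powr_realpow) (simp_all add: n)
    then have powr_n: "real n powr a = real m powr (2 * real c * a)" for a
      by (simp add: powr_powr)
    have "real n powr (1 / real c) = real m powr 2"
      using c by (simp add: powr_n)
    then have n_1c: "real n powr (1 / real c) = real (m\<^sup>2)"
      using m by simp
    have "real n powr ((real c - 1) / real c) = real m powr real (2 * (c - 1))"
      using c by (simp add: powr_n of_nat_diff)
    also have "\<dots> = real m ^ (2 * (c - 1))"
      using m by (subst powr_realpow) simp_all
    finally have n_c1: "real n powr ((real c - 1) / real c) = real N"
      by (simp add: N_def power_mult)
    have "length (srv In) = n"
      using srv xs unfolding initial_server_def shuffle_input_def by (metis length_map)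
    \<comment> \<open>Three arrays have n cells each; M was chosen so that the two auxiliary ones
      together have exactly N * M.\<close>
    then have "storage_size srv = 3 * n + N * M"
      using srv by (simp add: storage_size_def initial_server_def n N_def M_def algebra_simps)
    then have storage: "real (storage_size srv) \<le> (3 + C) * real n"
      using NM by (simp add: algebra_simps)
    have "1 \<le> c" using c by simp
    note lim = melbourne_run_limits[OF this m M run, folded N_def]
    show "real (num_operations s) \<le> 90 * C * real c * real n powr ((real c - 1) / real c)"
    proof -
      have "real (num_operations s) \<le> real (8 * c * N)"
        using lim(2) by (rule of_nat_mono)
      also have "\<dots> \<le> 90 * C * (real c * real N)"
        using C mult_right_mono[of 8 "90 * C" "real c * real N"] by simp
      finally show ?thesis by (simp add: n_c1 mult.assoc)
    qed
    have M2: "real (2 * M) \<le> 90 * C * real n powr (1 / real c)"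
      using M_le C by (simp add: n_1c)
    show "real len \<le> 90 * C * real n powr (1 / real c)" if "len \<in> set (messages s)" for len
    proof -
      have "len \<le> 2 * M" using lim(1) that by (auto simp: within_limits_def)
      then show ?thesis using M2 by linarith
    qed
    show "real (user_peak s) \<le> 90 * C * real n powr (1 / real c)"
    proof -
      have "user_peak s \<le> 2 * M" using lim(1) by (simp add: within_limits_def)
      then show ?thesis using M2 by linarith
    qed
    show "real (server_peak s) \<le> 90 * C * real n"
    proof -
      have "real (server_peak s) \<le> (3 + C) * real n"
        using lim(1) storage by (auto simp: within_limits_def)
      also have "\<dots> \<le> 90 * C * real n" using C by (intro mult_right_mono) simp_all
      finally show ?thesis .
    qed
    have "real (user_work s) \<le> real (90 * c * (N * M))"
      using lim(3) by (rule of_nat_mono)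
    also have "\<dots> = 90 * real c * real (N * M)" by simp
    also have "\<dots> \<le> 90 * real c * (C * real n)"
      using NM by (intro mult_left_mono) simp_all
    finally show user: "real (user_work s) \<le> 90 * C * real c * real n"
      by (simp add: mult_ac)
    have "server_work s \<le> user_work s" using lim(1) by (simp add: within_limits_def)
    then show "real (server_work s) \<le> 90 * C * real c * real n" using user by linarith
  qed
qed

end
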